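(* Let $T\in G$ be an involutory element (i.e. $T^2=I$), written as $T=e^{i\theta}\begin{bmatrix} UA & U(\xi)\\ \langle\cdot,\xi\rangle & a\end{bmatrix}$, where $\theta\in\mathbb{R}$, $\xi\in H$ with $\xi\neq0$, $a=\sqrt{1+\|\xi\|^2}$, $U$ is a unitary operator on $H$, and $A$ is the positive operator on $H$ with $A(\xi)=a\xi$ and $A=I$ on $\langle\xi\rangle^{\perp}$. Then: (1) $T=\varepsilon\begin{bmatrix} UA & -\xi\\ \langle\cdot,\xi\rangle & a\end{bmatrix}$ for some $\varepsilon\in\{1,-1\}$, where $U$ is involutory. (2) $T=T_1\oplus T_2$ with respect to $H\oplus\mathbb{C}=(\langle\xi\rangle\oplus\mathbb{C})\oplus\langle\xi\rangle^{\perp}$, where $T_1=T\restriction_{\langle\xi\rangle\oplus\mathbb{C}}$ and $T_2=\varepsilon\,U\restriction_{\langle\xi\rangle^{\perp}}$. (3) $\sigma(T)=\{1,-1\}$, and $\sigma(T_1)=\{1,-1\}$, the two eigenspaces of $T_1$ being the lines spanned by $\left(\dfrac{-a+1}{\|\xi\|^2}\,\xi,\,1\right)$ and $\left(\dfrac{-a-1}{\|\xi\|^2}\,\xi,\,1\right)$. (4) $T$ is elliptic.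
   Context: $H$ is an infinite-dimensional complex Hilbert space with inner product $\langle\cdot,\cdot\rangle$ linear in the first variable; $B$ is its open unit ball. On $H\oplus\mathbb{C}$ consider the sesquilinear form $\mathcal{A}((x,\lambda),(y,\mu))=\langle x,y\rangle-\lambda\overline{\mu}$. $G$ is the group of all bijective linear operators on $H\oplus\mathbb{C}$ leaving $\mathcal{A}$ invariant; every element of $G$ has the displayed form with some $\xi\in H$. A block matrix $\begin{bmatrix} P & \eta\\ \langle\cdot,\zeta\rangle & c\end{bmatrix}$ denotes the operator $(x,z)\mapsto (P(x)+z\eta,\ \langle x,\zeta\rangle+cz)$ on $H\oplus\mathbb{C}$. $\langle\xi\rangle$ is the linear span of $\xi$, and $\langle\xi\rangle^{\perp}$ (orthogonal complement in $H$) is identified with $\langle\xi\rangle^{\perp}\oplus0$. An operator is involutory if its square is the identity; $\sigma(\cdot)$ is the spectrum. Each $T=\begin{bmatrix} P & \eta\\ \langle\cdot,\zeta\rangle & c\end{bmatrix}\in G$ induces a biholomorphic bijection $\widetilde{T}$ of $B$, $\widetilde{T}(x)=\dfrac{P(x)+\eta}{\langle x,\zeta\rangle+c}$; $T$ is called elliptic if $\widetilde{T}$ has a fixed point in $B$. *)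

theory Defs
  imports "HOL-Analysis.Analysis"
begin

class scaleC =
  fixes scaleC :: "complex \<Rightarrow> 'a \<Rightarrow> 'a"  (infixr "*\<^sub>C" 75)

class complex_vector = scaleC + ab_group_add +
  assumes scaleC_add_right: "c *\<^sub>C (x + y) = c *\<^sub>C x + c *\<^sub>C y"
    and scaleC_add_left: "(c + d) *\<^sub>C x = c *\<^sub>C x + d *\<^sub>C x"
    and scaleC_scaleC: "c *\<^sub>C d *\<^sub>C x = (c * d) *\<^sub>C x"
    and scaleC_one: "1 *\<^sub>C x = x"

text \<open>The inner product is linear in the first variable; norm, metric and topology are those
  induced by it.\<close>

class complex_inner = real_normed_vector + complex_vector +
  fixes cinner :: "'a \<Rightarrow> 'a \<Rightarrow> complex"
  assumes scaleR_scaleC: "r *\<^sub>R x = complex_of_real r *\<^sub>C x"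
    and cinner_add_left: "cinner (x + y) z = cinner x z + cinner y z"
    and cinner_scaleC_left: "cinner (c *\<^sub>C x) y = c * cinner x y"
    and cinner_commute: "cinner x y = cnj (cinner y x)"
    and cinner_ge_zero: "0 \<le> Re (cinner x x)"
    and cinner_eq_zero_iff: "cinner x x = 0 \<longleftrightarrow> x = 0"
    and norm_eq_sqrt_cinner: "norm x = sqrt (Re (cinner x x))"

class complex_hilbert = complex_inner + complete_space

interpretation complex_vector:
  vector_space "scaleC :: complex \<Rightarrow> 'a \<Rightarrow> 'a::complex_vector"
  by standard (rule scaleC_add_right scaleC_add_left scaleC_scaleC scaleC_one)+

instantiation complex :: complex_hilbert
begin

definition scaleC_complex :: "complex \<Rightarrow> complex \<Rightarrow> complex"
  where "scaleC_complex c x = c * x"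

definition cinner_complex :: "complex \<Rightarrow> complex \<Rightarrow> complex"
  where "cinner_complex x y = x * cnj y"

instance
  by standard
    (simp_all add: scaleC_complex_def cinner_complex_def algebra_simps scaleR_conv_of_real
      cmod_def power2_eq_square)

end

instantiation prod :: (complex_vector, complex_vector) complex_vector
begin

definition scaleC_prod :: "complex \<Rightarrow> 'a \<times> 'b \<Rightarrow> 'a \<times> 'b"
  where "scaleC_prod c v = (c *\<^sub>C fst v, c *\<^sub>C snd v)"

instance
  by standard
    (simp_all add: scaleC_prod_def scaleC_add_right scaleC_add_left scaleC_scaleC scaleC_one)

end

instantiation prod :: (complex_inner, complex_inner) complex_inner
begin

definition cinner_prod :: "'a \<times> 'b \<Rightarrow> 'a \<times> 'b \<Rightarrow> complex"
  where "cinner_prod v w = cinner (fst v) (fst w) + cinner (snd v) (snd w)"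

instance
proof
  fix r :: real and c :: complex and x y z :: "'a \<times> 'b"
  show "r *\<^sub>R x = complex_of_real r *\<^sub>C x"
    by (simp add: scaleC_prod_def scaleR_prod_def scaleR_scaleC)
  show "cinner (x + y) z = cinner x z + cinner y z"
    by (simp add: cinner_prod_def cinner_add_left)
  show "cinner (c *\<^sub>C x) y = c * cinner x y"
    by (simp add: cinner_prod_def scaleC_prod_def cinner_scaleC_left algebra_simps)
  show "cinner x y = cnj (cinner y x)"
    using cinner_commute[of "fst x" "fst y"] cinner_commute[of "snd x" "snd y"]
    by (simp add: cinner_prod_def)
  show "0 \<le> Re (cinner x x)"
    by (simp add: cinner_prod_def cinner_ge_zero)
  have im: "Im (cinner u u) = 0" for u :: "'c::complex_inner"
    using arg_cong[OF cinner_commute[of u u], of Im] by simp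
  have "cinner x x = 0 \<longleftrightarrow> Re (cinner (fst x) (fst x)) = 0 \<and> Re (cinner (snd x) (snd x)) = 0"
    using cinner_ge_zero[of "fst x"] cinner_ge_zero[of "snd x"]
    by (auto simp: cinner_prod_def complex_eq_iff im)
  also have "\<dots> \<longleftrightarrow> cinner (fst x) (fst x) = 0 \<and> cinner (snd x) (snd x) = 0"
    by (simp add: complex_eq_iff im)
  finally show "cinner x x = 0 \<longleftrightarrow> x = 0"
    by (simp add: cinner_eq_zero_iff prod_eq_iff)
  show "norm x = sqrt (Re (cinner x x))"
    by (simp add: norm_prod_def norm_eq_sqrt_cinner cinner_prod_def cinner_ge_zero)
qed

end

instance prod :: (complex_hilbert, complex_hilbert) complex_hilbert ..

abbreviation cspan :: "'a::complex_vector set \<Rightarrow> 'a set"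
  where "cspan \<equiv> module.span scaleC"

abbreviation csubspace :: "'a::complex_vector set \<Rightarrow> bool"
  where "csubspace \<equiv> module.subspace scaleC"

abbreviation clinear :: "('a::complex_vector \<Rightarrow> 'b::complex_vector) \<Rightarrow> bool"
  where "clinear \<equiv> Vector_Spaces.linear scaleC scaleC"

definition infinite_dimensional :: "'a::complex_vector itself \<Rightarrow> bool"
  where "infinite_dimensional _ \<longleftrightarrow> \<not> (\<exists>S::'a set. finite S \<and> cspan S = UNIV)"

definition orth_compl :: "'a::complex_inner set \<Rightarrow> 'a set"
  where "orth_compl S = {x. \<forall>y\<in>S. cinner x y = 0}"

definition unitary :: "('a::complex_inner \<Rightarrow> 'a) \<Rightarrow> bool"
  where "unitary U \<longleftrightarrow> clinear U \<and> bij U \<and> (\<forall>x y. cinner (U x) (U y) = cinner x y)"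

definition positive_operator :: "('a::complex_inner \<Rightarrow> 'a) \<Rightarrow> bool"
  where "positive_operator A \<longleftrightarrow> clinear A \<and> bounded_linear A \<and>
    (\<forall>x. cinner (A x) x \<in> \<real> \<and> 0 \<le> Re (cinner (A x) x))"

definition involutory :: "('a \<Rightarrow> 'a) \<Rightarrow> bool"
  where "involutory T \<longleftrightarrow> T \<circ> T = id"

definition bounded_clinear_on :: "'a::complex_inner set \<Rightarrow> ('a \<Rightarrow> 'a) \<Rightarrow> bool"
  where "bounded_clinear_on M S \<longleftrightarrow> S \<in> M \<rightarrow> M \<and>
    (\<forall>x\<in>M. \<forall>y\<in>M. S (x + y) = S x + S y) \<and>
    (\<forall>c. \<forall>x\<in>M. S (c *\<^sub>C x) = c *\<^sub>C S x) \<and>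
    (\<exists>K. \<forall>x\<in>M. norm (S x) \<le> K * norm x)"

text \<open>Operators on a subspace \<open>M\<close> are represented by functions on the whole type whose values
  outside \<open>M\<close> are irrelevant; only the restriction to \<open>M\<close> enters the following notions.\<close>

definition spectrum_on :: "'a::complex_inner set \<Rightarrow> ('a \<Rightarrow> 'a) \<Rightarrow> complex set"
  where "spectrum_on M T = {k. \<not> (\<exists>S. bounded_clinear_on M S \<and>
    (\<forall>x\<in>M. S (T x - k *\<^sub>C x) = x \<and> T (S x) - k *\<^sub>C S x = x))}"

abbreviation spectrum :: "('a::complex_inner \<Rightarrow> 'a) \<Rightarrow> complex set"
  where "spectrum \<equiv> spectrum_on UNIV"

definition eigenspace_on :: "'a::complex_vector set \<Rightarrow> ('a \<Rightarrow> 'a) \<Rightarrow> complex \<Rightarrow> 'a set"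
  where "eigenspace_on M T k = {x \<in> M. T x = k *\<^sub>C x}"

text \<open>\<open>T = T\<^sub>1 \<oplus> T\<^sub>2\<close> with respect to the orthogonal decomposition of the space into \<open>M\<close> and
  \<open>N\<close>.\<close>

definition operator_direct_sum ::
    "('a::complex_inner \<Rightarrow> 'a) \<Rightarrow> 'a set \<Rightarrow> ('a \<Rightarrow> 'a) \<Rightarrow> 'a set \<Rightarrow> ('a \<Rightarrow> 'a) \<Rightarrow> bool"
  where "operator_direct_sum T M T\<^sub>1 N T\<^sub>2 \<longleftrightarrow>
    csubspace M \<and> csubspace N \<and>
    (\<forall>x\<in>M. \<forall>y\<in>N. cinner x y = 0) \<and> (\<forall>v. \<exists>x\<in>M. \<exists>y\<in>N. v = x + y) \<and>
    bounded_clinear_on M T\<^sub>1 \<and> bounded_clinear_on N T\<^sub>2 \<and>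
    (\<forall>x\<in>M. \<forall>y\<in>N. T (x + y) = T\<^sub>1 x + T\<^sub>2 y)"

definition form_A :: "'a::complex_inner \<times> complex \<Rightarrow> 'a \<times> complex \<Rightarrow> complex"
  where "form_A v w = cinner (fst v) (fst w) - snd v * cnj (snd w)"

definition group_G :: "('a::complex_inner \<times> complex \<Rightarrow> 'a \<times> complex) set"
  where "group_G = {T. clinear T \<and> bij T \<and> (\<forall>v w. form_A (T v) (T w) = form_A v w)}"

definition block_op :: "('a::complex_inner \<Rightarrow> 'a) \<Rightarrow> 'a \<Rightarrow> 'a \<Rightarrow> complex
    \<Rightarrow> 'a \<times> complex \<Rightarrow> 'a \<times> complex"
  where "block_op P \<eta> \<zeta> c = (\<lambda>(x, z). (P x + z *\<^sub>C \<eta>, cinner x \<zeta> + c * z))"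

text \<open>For a block operator \<open>T\<close> one has \<open>T (x, 1) = (P x + \<eta>, \<langle>x, \<zeta>\<rangle> + c)\<close>, so that
  the induced map is \<open>x \<mapsto> (P x + \<eta>) / (\<langle>x, \<zeta>\<rangle> + c)\<close>; the denominator does not vanish on
  the open unit ball when \<open>T\<close> is in \<open>group_G\<close>.\<close>

definition induced_map :: "('a::complex_inner \<times> complex \<Rightarrow> 'a \<times> complex) \<Rightarrow> 'a \<Rightarrow> 'a"
  where "induced_map T x = inverse (snd (T (x, 1))) *\<^sub>C fst (T (x, 1))"

lemma induced_map_block_op:
  "induced_map (block_op P \<eta> \<zeta> c) x = inverse (cinner x \<zeta> + c) *\<^sub>C (P x + \<eta>)"
  by (simp add: induced_map_def block_op_def scaleC_one)

definition elliptic :: "('a::complex_inner \<times> complex \<Rightarrow> 'a \<times> complex) \<Rightarrow> bool"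
  where "elliptic T \<longleftrightarrow> T \<in> group_G \<and> (\<exists>x\<in>ball 0 1. induced_map T x = x)"

end

theory Submission
  imports Defs
begin

text \<open>Evaluating \<open>T\<^sup>2 = I\<close> at \<open>(\<xi>, 0)\<close> gives \<open>\<langle>U \<xi>, \<xi>\<rangle> = - \<parallel>\<xi>\<parallel>\<^sup>2\<close>, which is the
  equality case of Cauchy--Schwarz and forces \<open>U \<xi> = - \<xi>\<close>; evaluating it at \<open>(0, 1)\<close> then gives
  \<open>e\<^sup>2\<^sup>i\<^sup>\<theta> = 1\<close>. So \<open>T\<close> splits along \<open>\<langle>\<xi>\<rangle> \<oplus> \<complex>\<close>, where it is an explicit two-by-two matrix with
  eigenvalues \<open>\<plusminus>1\<close>. As \<open>T\<close> is an involution, \<open>(T + k) / (1 - k\<^sup>2)\<close> inverts \<open>T - k\<close> for all other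
  \<open>k\<close>. The first component of the eigenvector \<open>((1 - a) / \<parallel>\<xi>\<parallel>\<^sup>2 \<cdot> \<xi>, 1)\<close> is a fixed point of
  the induced map, and it lies in the ball since \<open>a - 1 < \<parallel>\<xi>\<parallel>\<close>.\<close>

section \<open>Sesquilinear calculus, norms and orthogonality\<close>

lemmas module_hom_of_clinear = Vector_Spaces.linear.axioms(3)
lemmas clinear_add = module_hom.add[OF module_hom_of_clinear]
lemmas clinear_scale = module_hom.scale[OF module_hom_of_clinear]
lemmas clinear_diff = module_hom.diff[OF module_hom_of_clinear]

lemma cinner_add_right: "cinner x (y + z) = cinner x y + cinner x z"
  by (metis cinner_add_left cinner_commute complex_cnj_add)

lemma cinner_scaleC_right: "cinner x (c *\<^sub>C y) = cnj c * cinner x y"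
  by (metis cinner_commute cinner_scaleC_left complex_cnj_mult)

lemma cinner_zero_left [simp]: "cinner 0 x = 0"
  using cinner_scaleC_left[of 0 0 x] by simp

lemma cinner_minus_left: "cinner (- x) y = - cinner x y"
  using cinner_add_left[of x "- x" y] by (simp add: eq_neg_iff_add_eq_0 add.commute)

lemma cinner_minus_right: "cinner x (- y) = - cinner x y"
  by (metis cinner_commute cinner_minus_left complex_cnj_minus)

lemma cinner_self: "cinner x x = complex_of_real ((norm x)\<^sup>2)"
proof -
  have "Im (cinner x x) = 0"
    using arg_cong[OF cinner_commute[of x x], of Im] by simp
  then show ?thesis
    by (simp add: complex_eq_iff norm_eq_sqrt_cinner cinner_ge_zero)
qed

lemma norm_scaleC: "norm (c *\<^sub>C x) = cmod c * norm (x :: 'a::complex_inner)"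
proof -
  have "complex_of_real ((norm (c *\<^sub>C x))\<^sup>2) = complex_of_real ((cmod c * norm x)\<^sup>2)"
    unfolding cinner_self[symmetric] cinner_scaleC_left cinner_scaleC_right
    by (simp add: cinner_self power_mult_distrib mult.assoc[symmetric] complex_norm_square
        flip: of_real_power)
  then have "(norm (c *\<^sub>C x))\<^sup>2 = (cmod c * norm x)\<^sup>2"
    by (simp only: of_real_eq_iff)
  then show ?thesis
    by (rule power2_eq_imp_eq) simp_all
qed

lemma norm_add_orthogonal:
  fixes x y :: "'a::complex_inner"
  assumes "cinner x y = 0"
  shows "(norm (x + y))\<^sup>2 = (norm x)\<^sup>2 + (norm y)\<^sup>2"
proof -
  have "cinner y x = 0"
    using assms cinner_commute[of y x] by simp
  then have "cinner (x + y) (x + y) = cinner x x + cinner y y"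
    using assms by (simp add: cinner_add_left cinner_add_right)
  then show ?thesis
    unfolding cinner_self by (metis of_real_add of_real_eq_iff)
qed

text \<open>Projection onto the line of \<open>y\<close>, with coefficient
  \<open>cinner x y / cinner y y\<close>; for \<open>y = 0\<close> the choice \<open>c = 0\<close>
  works. It serves Cauchy-Schwarz and later the splitting of H along \<xi>.\<close>

lemma orth_decomp:
  fixes x y :: "'a::complex_inner"
  obtains c w where "x = c *\<^sub>C y + w" "cinner w y = 0"
proof (cases "y = 0")
  case True
  then show ?thesis
    using that[of 0 x] cinner_commute[of x 0] by simp
next
  case False
  let ?c = "cinner x y / cinner y y"
  have "cinner y y \<noteq> 0"
    using False by (simp add: cinner_eq_zero_iff)
  then have "cinner (x - ?c *\<^sub>C y) y = 0"
    by (simp add: diff_conv_add_uminus cinner_add_left cinner_minus_left cinner_scaleC_left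
        del: add_uminus_conv_diff)
  then show ?thesis
    using that[of ?c "x - ?c *\<^sub>C y"] by simp
qed

text \<open>By Pythagoras the projection of \<open>x\<close> onto the line of \<open>y\<close> is no
  longer than \<open>x\<close>, and the inner product sees only this projection.\<close>

lemma norm_cinner_le:
  fixes x y :: "'a::complex_inner"
  shows "cmod (cinner x y) \<le> norm x * norm y"
proof -
  obtain c w where x: "x = c *\<^sub>C y + w" and w: "cinner w y = 0"
    by (rule orth_decomp)
  have "cinner (c *\<^sub>C y) w = 0"
    using w cinner_commute[of y w] by (simp add: cinner_scaleC_left)
  from norm_add_orthogonal[OF this] have "(norm (c *\<^sub>C y))\<^sup>2 \<le> (norm x)\<^sup>2"
    by (simp add: x)
  then have le: "norm (c *\<^sub>C y) \<le> norm x"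
    by (rule power2_le_imp_le) simp
  have "cmod (cinner x y) = norm (c *\<^sub>C y) * norm y"
    using w by (simp add: x cinner_add_left cinner_scaleC_left cinner_self norm_scaleC norm_mult
        norm_power power2_eq_square)
  then show ?thesis
    using le by (simp add: mult_right_mono)
qed

section \<open>Subspaces and bounded operators\<close>

lemma orth_compl_cspan_singleton:
  "orth_compl (cspan {y}) = {x. cinner x y = 0}"
  by (auto simp: orth_compl_def complex_vector.span_singleton cinner_scaleC_right
      dest: spec[of _ 1])

lemma csubspace_orth_compl: "csubspace (orth_compl S)"
  by (rule complex_vector.subspaceI)
    (auto simp: orth_compl_def cinner_add_left cinner_scaleC_left)

lemma csubspace_Times: "csubspace M \<Longrightarrow> csubspace N \<Longrightarrow> csubspace (M \<times> N)"
  by (auto simp: complex_vector.subspace_def scaleC_prod_def zero_prod_def plus_prod_def)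

lemma bounded_clinear_on_subset:
  assumes "bounded_clinear_on M S" "N \<subseteq> M" "S \<in> N \<rightarrow> N"
  shows "bounded_clinear_on N S"
  using assms unfolding bounded_clinear_on_def by (meson subsetD)

lemma clinear_imp_bounded_clinear_on_UNIV:
  assumes "clinear S" "\<And>x. norm (S x) \<le> K * norm x"
  shows "bounded_clinear_on UNIV S"
  unfolding bounded_clinear_on_def
  using assms(2) clinear_add[OF assms(1)] clinear_scale[OF assms(1)]
  by blast

text \<open>Each of the four entries contributes its own bound, since both coordinates of
  \<open>v\<close> are at most \<open>norm v\<close> and a pair is at most as long as its
  coordinates together.\<close>

lemma norm_block_op_le:
  assumes "0 \<le> K" "\<And>x. norm (P x) \<le> K * norm x"
  shows "norm (block_op P \<eta> \<zeta> c v) \<le> (K + norm \<eta> + norm \<zeta> + cmod c) * norm v"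
proof -
  obtain x z where v: "v = (x, z)" by (cases v)
  have x: "norm x \<le> norm v" and z: "cmod z \<le> norm v"
    unfolding v by (rule norm_fst_le, rule norm_snd_le)
  have "norm (P x + z *\<^sub>C \<eta>) \<le> K * norm x + cmod z * norm \<eta>"
    using norm_triangle_ineq[of "P x" "z *\<^sub>C \<eta>"] assms(2)[of x] by (simp add: norm_scaleC)
  moreover have "cmod (cinner x \<zeta> + c * z) \<le> norm x * norm \<zeta> + cmod c * cmod z"
    using norm_triangle_ineq[of "cinner x \<zeta>" "c * z"] norm_cinner_le[of x \<zeta>]
    by (simp add: norm_mult)
  moreover have "K * norm x \<le> K * norm v"
    using x assms(1) by (rule mult_left_mono)
  moreover have "norm x * norm \<zeta> \<le> norm v * norm \<zeta>" "cmod z * norm \<eta> \<le> norm v * norm \<eta>"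
    "cmod c * cmod z \<le> cmod c * norm v"
    using x z by (simp_all add: mult_left_mono mult_right_mono)
  moreover have "norm (block_op P \<eta> \<zeta> c v) \<le>
      norm (P x + z *\<^sub>C \<eta>) + cmod (cinner x \<zeta> + c * z)"
    unfolding block_op_def v using norm_Pair_le by simp
  ultimately show ?thesis
    by (simp add: algebra_simps)
qed

text \<open>An eigenvalue excludes an inverse, and \<open>(T - k) (T + k) = 1 - k * k\<close>
  supplies one for every other \<open>k\<close>. Stating this relative to \<open>M\<close> covers
  both the whole space and the summand carrying \<open>T\<^sub>1\<close>.\<close>

lemma spectrum_on_involution:
  assumes M: "csubspace M" and T: "bounded_clinear_on M T"
    and inv: "\<And>x. x \<in> M \<Longrightarrow> T (T x) = x"
    and u: "u \<in> M" "u \<noteq> 0" "T u = u" and v: "v \<in> M" "v \<noteq> 0" "T v = - v"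
  shows "spectrum_on M T = {1, -1}"
proof -
  have eigenvalue: "k \<in> spectrum_on M T" if "w \<in> M" "w \<noteq> 0" "T w = k *\<^sub>C w" for k w
  proof -
    have "\<not> (bounded_clinear_on M S \<and>
        (\<forall>x\<in>M. S (T x - k *\<^sub>C x) = x \<and> T (S x) - k *\<^sub>C S x = x))" for S
    proof
      assume S: "bounded_clinear_on M S \<and>
        (\<forall>x\<in>M. S (T x - k *\<^sub>C x) = x \<and> T (S x) - k *\<^sub>C S x = x)"
      \<comment> \<open>\<open>S\<close> is linear on \<open>M\<close> only, so
        \<open>S 0 = 0\<close> is obtained by scaling the member \<open>w\<close> by 0; yet
        \<open>T w - k *\<^sub>C w = 0\<close> forces \<open>S 0 = w\<close>.\<close>
      then have "S (0 *\<^sub>C w) = 0 *\<^sub>C S w"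
        using that(1) unfolding bounded_clinear_on_def by blast
      then have "S 0 = 0" by simp
      moreover have "S 0 = w"
        using S that by force
      ultimately show False using that(2) by simp
    qed
    then show ?thesis unfolding spectrum_on_def by blast
  qed
  have "k \<notin> spectrum_on M T" if k: "k \<noteq> 1" "k \<noteq> -1" for k
  proof -
    define d where "d = inverse (1 - k * k)"
    have "1 - k * k = (1 - k) * (1 + k)" by (simp add: algebra_simps)
    moreover have "1 + k \<noteq> 0" using k(2) by (metis add.commute eq_neg_iff_add_eq_0)
    ultimately have nz: "1 - k * k \<noteq> 0" using k(1) by simp
    have dk: "d * (1 - k * k) = 1" using nz by (simp add: d_def)
    define S where "S x = d *\<^sub>C (T x + k *\<^sub>C x)" for x
    have TM: "T x \<in> M" if "x \<in> M" for x
      using T that unfolding bounded_clinear_on_def by auto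
    have T_add: "T (x + y) = T x + T y" if "x \<in> M" "y \<in> M" for x y
      using T that unfolding bounded_clinear_on_def by auto
    have T_scale: "T (c *\<^sub>C x) = c *\<^sub>C T x" if "x \<in> M" for c x
      using T that unfolding bounded_clinear_on_def by auto
    have scaleM: "c *\<^sub>C x \<in> M" if "x \<in> M" for c x
      using M that by (rule complex_vector.subspace_scale)
    have addM: "x + y \<in> M" if "x \<in> M" "y \<in> M" for x y
      using M that by (rule complex_vector.subspace_add)
    obtain K where K: "\<And>x. x \<in> M \<Longrightarrow> norm (T x) \<le> K * norm x"
      using T unfolding bounded_clinear_on_def by blast
    have bound: "norm (S x) \<le> (cmod d * (K + cmod k)) * norm x" if "x \<in> M" for x
    proof -
      have "norm (T x + k *\<^sub>C x) \<le> (K + cmod k) * norm x"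
        using norm_triangle_ineq[of "T x" "k *\<^sub>C x"] K[OF that]
        by (simp add: norm_scaleC algebra_simps)
      then show ?thesis
        by (simp add: S_def norm_scaleC mult.assoc mult_left_mono)
    qed
    have "bounded_clinear_on M S"
      unfolding bounded_clinear_on_def
    proof (intro conjI ballI allI exI)
      show "S \<in> M \<rightarrow> M" by (simp add: S_def TM addM scaleM)
      show "S (x + y) = S x + S y" if "x \<in> M" "y \<in> M" for x y
        using that by (simp add: S_def T_add scaleC_add_right algebra_simps)
      show "S (c *\<^sub>C x) = c *\<^sub>C S x" if "x \<in> M" for c x
        using that by (simp add: S_def T_scale scaleC_add_right scaleC_scaleC algebra_simps)
      show "norm (S x) \<le> (cmod d * (K + cmod k)) * norm x" if "x \<in> M" for x
        using that by (rule bound)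
    qed
    moreover have "S (T x - k *\<^sub>C x) = x" "T (S x) - k *\<^sub>C S x = x" if x: "x \<in> M" for x
    proof -
      have "T (S x) - k *\<^sub>C S x = (d * (1 - k * k)) *\<^sub>C x"
        using x by (simp add: S_def T_scale T_add TM scaleM addM inv scaleC_add_right
            scaleC_scaleC right_diff_distrib complex_vector.scale_left_diff_distrib algebra_simps)
      then show "T (S x) - k *\<^sub>C S x = x" by (simp add: dk scaleC_one)
      \<comment> \<open>The difference is rewritten as a sum of members of \<open>M\<close>, the
        form to which additivity and homogeneity on \<open>M\<close> apply.\<close>
      have "T (T x + (- k) *\<^sub>C x) = x + (- k) *\<^sub>C T x"
        using x by (simp only: T_add T_scale TM scaleM inv)
      then have "S (T x + (- k) *\<^sub>C x) = (d * (1 - k * k)) *\<^sub>C x"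
        by (simp add: S_def scaleC_add_right
            scaleC_scaleC right_diff_distrib complex_vector.scale_left_diff_distrib algebra_simps)
      then show "S (T x - k *\<^sub>C x) = x" by (simp add: dk scaleC_one)
    qed
    ultimately show ?thesis unfolding spectrum_on_def by blast
  qed
  moreover have "1 \<in> spectrum_on M T" "-1 \<in> spectrum_on M T"
    using eigenvalue[of u 1] eigenvalue[of v "-1"] u v by (simp_all add: scaleC_one)
  ultimately show ?thesis by auto
qed

theorem proposition3p8:
  fixes T :: "'a::complex_hilbert \<times> complex \<Rightarrow> 'a \<times> complex"
    and U A :: "'a \<Rightarrow> 'a"
    and \<xi> :: 'a
    and \<theta> a :: real
  assumes "infinite_dimensional TYPE('a)"
    and "T \<in> group_G"
    and "involutory T"
    and "\<xi> \<noteq> 0"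
    and "a = sqrt (1 + (norm \<xi>)\<^sup>2)"
    and "unitary U"
    and "positive_operator A"
    and "A \<xi> = complex_of_real a *\<^sub>C \<xi>"
    and "\<forall>x\<in>orth_compl (cspan {\<xi>}). A x = x"
    and "T = (\<lambda>v. exp (\<i> * complex_of_real \<theta>) *\<^sub>C
               block_op (U \<circ> A) (U \<xi>) \<xi> (complex_of_real a) v)"
  shows "\<exists>\<epsilon>\<in>{1, -1 :: complex}.
      T = (\<lambda>v. \<epsilon> *\<^sub>C block_op (U \<circ> A) (- \<xi>) \<xi> (complex_of_real a) v) \<and>
      involutory U \<and>
      operator_direct_sum T
        (cspan {\<xi>} \<times> UNIV) T
        (orth_compl (cspan {\<xi>}) \<times> {0}) (\<lambda>(x, z). (\<epsilon> *\<^sub>C U x, 0)) \<and>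
      spectrum T = {1, -1} \<and>
      spectrum_on (cspan {\<xi>} \<times> UNIV) T = {1, -1} \<and>
      eigenspace_on (cspan {\<xi>} \<times> UNIV) T ` {1, -1} =
        {cspan {(complex_of_real ((- a + 1) / (norm \<xi>)\<^sup>2) *\<^sub>C \<xi>, 1)},
         cspan {(complex_of_real ((- a - 1) / (norm \<xi>)\<^sup>2) *\<^sub>C \<xi>, 1)}} \<and>
      elliptic T"
proof -
  define n where "n = (norm \<xi>)\<^sup>2"
  define M where "M = cspan {\<xi>} \<times> (UNIV :: complex set)"
  define N where "N = orth_compl (cspan {\<xi>}) \<times> {0 :: complex}"
  define e where "e = exp (\<i> * complex_of_real \<theta>)"
  have n: "n > 0" using assms(4) by (simp add: n_def)
  have a2: "a\<^sup>2 = 1 + n" and a1: "a > 1"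
    using n by (simp_all add: assms(5) n_def)
  have a2': "complex_of_real a * complex_of_real a = 1 + complex_of_real n"
    using a2 by (metis of_real_1 of_real_add of_real_mult power2_eq_square)
  have \<xi>\<xi>: "cinner \<xi> \<xi> = complex_of_real n" by (simp add: cinner_self n_def)
  have T: "clinear T" using assms(2) by (simp add: group_G_def)
  note T_add = clinear_add[OF T] and T_scale = clinear_scale[OF T]
  have TT: "T (T v) = v" for v using assms(3) by (metis involutory_def comp_apply id_apply)
  have U: "clinear U" and UU: "\<And>x y. cinner (U x) (U y) = cinner x y"
    using assms(6) by (auto simp: unitary_def)
  note U_add = clinear_add[OF U] and U_scale = clinear_scale[OF U]
  have A: "clinear A" using assms(7) by (simp add: positive_operator_def)
  note A_add = clinear_add[OF A] and A_scale = clinear_scale[OF A]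
  have A_orth: "A x = x" if "cinner x \<xi> = 0" for x
    using assms(9) that by (simp add: orth_compl_cspan_singleton)
  have Tv: "T (x, z) = (e *\<^sub>C (U (A x) + z *\<^sub>C U \<xi>), e * (cinner x \<xi> + a * z))"
    for x and z :: complex
    by (simp add: assms(10) e_def block_op_def scaleC_prod_def scaleC_complex_def)
  have e0: "e \<noteq> 0" by (simp add: e_def)

  \<comment> \<open>Consequences of the involution: \<open>U \<xi>\<close>, the sign, and
    \<open>U\<close>\<close>
  have U\<xi>: "U \<xi> = - \<xi>"
  proof -
    \<comment> \<open>Only the second coordinate of the next application of \<open>T\<close> is
      used: the first would contain \<open>A (U \<xi>)\<close>, still unknown here.\<close>
    have "T (\<xi>, 0) = (e * a) *\<^sub>C (U \<xi>, 0) + (e * n) *\<^sub>C (0, 1)"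
      by (simp add: Tv assms(8) U_scale scaleC_scaleC \<xi>\<xi> scaleC_prod_def scaleC_complex_def)
    then have "snd (T (T (\<xi>, 0))) = e * e * a * (cinner (U \<xi>) \<xi> + n)"
      by (simp add: T_add T_scale) (simp add: Tv scaleC_prod_def scaleC_complex_def algebra_simps)
    then have "cinner (U \<xi>) \<xi> = - complex_of_real n"
      using e0 a1 by (simp add: TT eq_neg_iff_add_eq_0)
    moreover from this have "cinner \<xi> (U \<xi>) = - complex_of_real n"
      using cinner_commute[of \<xi> "U \<xi>"] by simp
    \<comment> \<open>The four terms of the expansion are \<open>n\<close>, \<open>-n\<close>,
      \<open>-n\<close> and \<open>n\<close>, as \<open>U\<close> is isometric.\<close>
    ultimately have "cinner (U \<xi> + \<xi>) (U \<xi> + \<xi>) = 0"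
      by (simp add: cinner_add_left cinner_add_right UU \<xi>\<xi>)
    then show ?thesis
      by (simp add: cinner_eq_zero_iff eq_neg_iff_add_eq_0)
  qed
  have T_M: "T (s *\<^sub>C \<xi>, z) = ((- e * (a * s + z)) *\<^sub>C \<xi>, e * (s * n + a * z))" for s z :: complex
    by (simp add: Tv A_scale assms(8) U_scale U\<xi> cinner_scaleC_left \<xi>\<xi> scaleC_add_right
        scaleC_add_left scaleC_scaleC algebra_simps)
  have ee: "e * e = 1"
  proof -
    \<comment> \<open>The zero vector is written as a multiple of \<xi> so that \<open>T_M\<close>
      applies; the second coordinate gives \<open>e * e * (a * a - n) = 1\<close>.\<close>
    have "T (T (0 *\<^sub>C \<xi>, 1)) = (0 *\<^sub>C \<xi>, 1)" by (rule TT)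
    then have "e * e * (complex_of_real a * complex_of_real a - n) = 1"
      by (simp only: T_M prod.inject) (simp add: algebra_simps)
    then show ?thesis by (simp add: a2')
  qed
  then have e: "e = 1 \<or> e = -1" by (simp add: square_eq_1_iff)
  have U_orth: "cinner (U x) \<xi> = 0" if "cinner x \<xi> = 0" for x
    using UU[of x \<xi>] that by (simp add: U\<xi> cinner_minus_right)
  have T_N: "T (x, 0) = (e *\<^sub>C U x, 0)" if "cinner x \<xi> = 0" for x
    using that by (simp add: Tv A_orth)
  \<comment> \<open>On the line of \<xi> this follows from \<open>U \<xi> = - \<xi>\<close>; on the
    complement \<open>T\<close> acts as \<open>e\<close> times \<open>U\<close>, so \<open>T\<close>
    squared is \<open>U\<close> squared there.\<close>
  have "U (U x) = x" for x
  proof -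
    obtain c w where x: "x = c *\<^sub>C \<xi> + w" and w: "cinner w \<xi> = 0"
      by (rule orth_decomp)
    have "T (T (w, 0)) = (w, 0)" by (rule TT)
    moreover have "cinner (e *\<^sub>C U w) \<xi> = 0"
      using w by (simp add: U_orth cinner_scaleC_left)
    ultimately have "U (U w) = w"
      using w by (simp add: T_N U_scale scaleC_scaleC ee scaleC_one)
    then show ?thesis
      by (simp add: x U_add U_scale U\<xi> clinear_diff[OF U])
  qed
  then have invU: "involutory U" by (simp add: involutory_def fun_eq_iff)

  \<comment> \<open>Boundedness and the direct sum decomposition\<close>
  obtain K where K: "0 \<le> K" "\<And>x. norm (A x) \<le> norm x * K"
    using assms(7) bounded_linear.nonneg_bounded[of A] by (auto simp: positive_operator_def)
  have normU: "norm (U x) = norm x" for x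
    by (simp add: norm_eq_sqrt_cinner UU)
  have bT: "bounded_clinear_on UNIV T"
  proof (rule clinear_imp_bounded_clinear_on_UNIV[OF T])
    show "norm (T v) \<le> (K + norm (U \<xi>) + norm \<xi> + cmod a) * norm v" for v
      using norm_block_op_le[of K "U \<circ> A" "U \<xi>" \<xi> a v] K
      by (simp add: assms(10) norm_scaleC normU mult.commute)
  qed
  have M_eq: "M = {(s *\<^sub>C \<xi>, z) | s z. True}"
    by (auto simp: M_def complex_vector.span_singleton)
  have sM: "csubspace M"
    unfolding M_def
    by (intro csubspace_Times complex_vector.subspace_span complex_vector.subspace_UNIV)
  have sN: "csubspace N"
    unfolding N_def
    by (intro csubspace_Times csubspace_orth_compl complex_vector.subspace_single_0)
  have N_eq: "N = {(x, 0) | x. cinner x \<xi> = 0}"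
    by (auto simp: N_def orth_compl_cspan_singleton)
  have bM: "bounded_clinear_on M T"
    by (rule bounded_clinear_on_subset[OF bT])
      (auto simp: M_eq T_M simp del: complex_vector.scale_minus_left)
  have bN: "bounded_clinear_on N T"
    by (rule bounded_clinear_on_subset[OF bT])
      (auto simp: N_eq T_N cinner_scaleC_left U_orth)
  have bN2: "bounded_clinear_on N (\<lambda>(x, z). (e *\<^sub>C U x, 0))"
  proof -
    \<comment> \<open>The two operators agree on \<open>N\<close>, so boundedness and linearity
      there carry over from \<open>T\<close>.\<close>
    have "(\<lambda>(x, z). (e *\<^sub>C U x, 0)) v = T v" if "v \<in> N" for v
      using that by (auto simp: N_eq T_N)
    with bN sN show ?thesis
      unfolding bounded_clinear_on_def
      by (simp add: Pi_iff complex_vector.subspace_add complex_vector.subspace_scale)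
  qed
  have sum: "operator_direct_sum T M T N (\<lambda>(x, z). (e *\<^sub>C U x, 0))"
    unfolding operator_direct_sum_def
  proof (intro conjI ballI allI)
    show "cinner v w = 0" if "v \<in> M" "w \<in> N" for v w
      using that cinner_commute[of \<xi> "fst w"]
      by (auto simp: M_eq N_eq cinner_prod_def cinner_scaleC_left cinner_complex_def)
    show "\<exists>x\<in>M. \<exists>y\<in>N. v = x + y" for v
    proof -
      obtain x z where v: "v = (x, z)" by (cases v)
      obtain c w where x: "x = c *\<^sub>C \<xi> + w" and w: "cinner w \<xi> = 0"
        by (rule orth_decomp)
      have "(c *\<^sub>C \<xi>, z) \<in> M" "(w, 0) \<in> N" "v = (c *\<^sub>C \<xi>, z) + (w, 0)"
        using w by (auto simp: M_eq N_eq v x)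
      then show ?thesis by blast
    qed
    show "T (v + w) = T v + (\<lambda>(x, z). (e *\<^sub>C U x, 0)) w" if "v \<in> M" "w \<in> N" for v w
      using that by (auto simp: N_eq T_N T_add)
  qed (fact sM sN bM bN2)+

  \<comment> \<open>Eigenvectors and eigenspaces of \<open>T\<^sub>1\<close>\<close>
  define t1 where "t1 = complex_of_real ((- a + 1) / n)"
  define t2 where "t2 = complex_of_real ((- a - 1) / n)"
  \<comment> \<open>For \<open>(t *\<^sub>C \<xi>, 1)\<close> the second row of \<open>T_M\<close>
    demands \<open>t * n + a = 1\<close> for eigenvalue \<open>e\<close> and
    \<open>t * n + a = -1\<close> for \<open>- e\<close>. The first row then holds because
    \<open>a * a = 1 + n\<close>.\<close>
  have t1: "t1 * n = 1 - complex_of_real a" and t2: "t2 * n = - complex_of_real a - 1"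
    using n by (simp_all add: t1_def t2_def)
  have "(a * t1 + 1 + t1) * n = 0"
    using t1 a2' by algebra
  then have t1': "a * t1 + 1 = - t1" using n by (simp add: eq_neg_iff_add_eq_0)
  have "(a * t2 + 1 - t2) * n = 0"
    using t2 a2' by algebra
  then have t2': "a * t2 + 1 = t2" using n by simp
  have eig1: "T (t1 *\<^sub>C \<xi>, 1) = e *\<^sub>C (t1 *\<^sub>C \<xi>, 1)"
    using t1 by (simp add: T_M t1' scaleC_prod_def scaleC_complex_def scaleC_scaleC)
  have eig2: "T (t2 *\<^sub>C \<xi>, 1) = (- e) *\<^sub>C (t2 *\<^sub>C \<xi>, 1)"
    using t2 by (simp add: T_M t2' scaleC_prod_def scaleC_complex_def scaleC_scaleC)
  have inM: "(t *\<^sub>C \<xi>, 1) \<in> M" for t by (auto simp: M_eq)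
  \<comment> \<open>The second coordinate of the eigenvalue equation already determines
    \<open>s\<close> from \<open>z\<close>; premise \<open>le\<close> isolates this, so the
    eigenspace is a single line.\<close>
  have line: "eigenspace_on M T k = cspan {(t *\<^sub>C \<xi>, 1)}"
    if eig: "T (t *\<^sub>C \<xi>, 1) = k *\<^sub>C (t *\<^sub>C \<xi>, 1)"
      and le: "\<And>(s::complex) (z::complex). e * (s * n + a * z) = k * z \<Longrightarrow> s = z * t" for k t
  proof (rule set_eqI)
    fix v
    show "v \<in> eigenspace_on M T k \<longleftrightarrow> v \<in> cspan {(t *\<^sub>C \<xi>, 1)}"
    proof
      assume "v \<in> eigenspace_on M T k"
      then obtain s z where v: "v = (s *\<^sub>C \<xi>, z)" and "T v = k *\<^sub>C v"
        by (auto simp: eigenspace_on_def M_eq)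
      then have "s = z * t"
        by (intro le) (simp add: T_M scaleC_prod_def scaleC_complex_def)
      then have "v = z *\<^sub>C (t *\<^sub>C \<xi>, 1)"
        by (simp add: v scaleC_prod_def scaleC_complex_def scaleC_scaleC)
      then show "v \<in> cspan {(t *\<^sub>C \<xi>, 1)}"
        by (auto simp: complex_vector.span_singleton)
    next
      assume "v \<in> cspan {(t *\<^sub>C \<xi>, 1)}"
      then obtain z where v: "v = z *\<^sub>C (t *\<^sub>C \<xi>, 1)"
        by (auto simp: complex_vector.span_singleton)
      have "T v = k *\<^sub>C v"
        unfolding v T_scale eig scaleC_scaleC by (simp add: mult.commute)
      moreover have "v \<in> M"
        unfolding v using sM inM by (rule complex_vector.subspace_scale)
      ultimately show "v \<in> eigenspace_on M T k" by (simp add: eigenspace_on_def)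
    qed
  qed
  have E1: "eigenspace_on M T e = cspan {(t1 *\<^sub>C \<xi>, 1)}"
  proof (rule line[OF eig1])
    fix s z :: complex
    assume "e * (s * n + a * z) = e * z"
    then have "s * n + a * z = z" using e0 by simp
    then have "s * n = z * (t1 * n)" unfolding t1
      by (simp add: eq_diff_eq right_diff_distrib mult.commute)
    then show "s = z * t1" using n by simp
  qed
  have E2: "eigenspace_on M T (- e) = cspan {(t2 *\<^sub>C \<xi>, 1)}"
  proof (rule line[OF eig2])
    fix s z :: complex
    assume "e * (s * n + a * z) = - e * z"
    then have "s * n + a * z = - z" using e0 by (metis minus_mult_commute mult_left_cancel)
    then have "s * n = - z - a * z" by (simp add: eq_diff_eq)
    moreover have "z * (t2 * n) = - z - a * z" unfolding t2 by (simp add: algebra_simps)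
    ultimately have "s * n = z * (t2 * n)" by simp
    then show "s = z * t2" using n by simp
  qed
  \<comment> \<open>Which line belongs to 1 depends on the sign \<open>e\<close>; the unordered set
    of eigenspaces does not.\<close>
  have pm: "{1, -1} = {e, - e}" using e by auto
  have eigs: "eigenspace_on M T ` {1, -1} = {cspan {(t1 *\<^sub>C \<xi>, 1)}, cspan {(t2 *\<^sub>C \<xi>, 1)}}"
    unfolding pm by (simp add: E1 E2)

  \<comment> \<open>Spectra of \<open>T\<^sub>1\<close> and \<open>T\<close>\<close>
  have nz: "(t *\<^sub>C \<xi>, 1 :: complex) \<noteq> 0" for t by (simp add: zero_prod_def)
  have "\<exists>u\<in>M. u \<noteq> 0 \<and> T u = k *\<^sub>C u" if "k = e \<or> k = - e" for k
    using that eig1 eig2 inM nz by blast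
  from this[of 1] this[of "-1"]
  have ev: "\<exists>u\<in>M. u \<noteq> 0 \<and> T u = u" "\<exists>v\<in>M. v \<noteq> 0 \<and> T v = - v"
    using e by (auto simp: scaleC_one)
  have spM: "spectrum_on M T = {1, -1}"
    using ev spectrum_on_involution[OF sM bM TT] by metis
  have sp: "spectrum T = {1, -1}"
    using ev spectrum_on_involution[OF complex_vector.subspace_UNIV bT TT] by (metis UNIV_I)

  \<comment> \<open>Ellipticity\<close>
  have "elliptic T"
  proof -
    \<comment> \<open>Compare \<open>1 + (norm \<xi>)\<^sup>2\<close> with the square of
      \<open>1 + norm \<xi>\<close>.\<close>
    have "a - 1 < norm \<xi>"
      using assms(4) by (simp add: assms(5) real_less_lsqrt algebra_simps power2_eq_square)
    have "norm (t1 *\<^sub>C \<xi>) = (a - 1) / norm \<xi>"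
      using a1 n by (simp add: norm_scaleC t1_def n_def norm_divide power2_eq_square
          del: of_real_divide)
    also have "\<dots> < 1"
      using \<open>a - 1 < norm \<xi>\<close> assms(4) by simp
    finally have "t1 *\<^sub>C \<xi> \<in> ball 0 1" by simp
    \<comment> \<open>By \<open>eig1\<close> both coordinates of the image carry the factor
      \<open>e\<close>, which cancels in the quotient.\<close>
    moreover have "induced_map T (t1 *\<^sub>C \<xi>) = t1 *\<^sub>C \<xi>"
      using e0 by (simp add: induced_map_def eig1 scaleC_prod_def scaleC_complex_def scaleC_scaleC
          scaleC_one)
    ultimately show ?thesis using assms(2) by (auto simp: elliptic_def)
  qed
  moreover have "T = (\<lambda>v. e *\<^sub>C block_op (U \<circ> A) (- \<xi>) \<xi> (complex_of_real a) v)"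
    unfolding assms(10) e_def U\<xi> ..
  moreover have "e \<in> {1, -1}" using e by simp
  ultimately show ?thesis
    using invU sum sp spM eigs unfolding M_def N_def t1_def t2_def n_def by blast
qed

end
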